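(* Let $R$ be a semiprime (associative, unital) ring and let $a,b\in Reg(R)$. Then $Ref(a)=Ref(b)$ if and only if $a=b$.
   Context: For an associative ring $R$ with unity and $a\in R$: $a$ is (von Neumann) regular if there exists $x\in R$ with $axa=a$, and $Reg(R)$ is the set of regular elements of $R$. A reflexive inverse of $a$ is an element $x\in R$ satisfying both $axa=a$ and $xax=x$; $Ref(a)$ denotes the set of reflexive inverses of $a$. The ring $R$ is semiprime if, for $c\in R$, $cRc=0$ implies $c=0$. *)

theory Defs
  imports "HOL-Algebra.Ring"
begin

definition Reg :: "('a, 'm) ring_scheme \<Rightarrow> 'a set" where
  "Reg R = {a \<in> carrier R. \<exists>x \<in> carrier R. a \<otimes>\<^bsub>R\<^esub> x \<otimes>\<^bsub>R\<^esub> a = a}"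

definition Ref :: "('a, 'm) ring_scheme \<Rightarrow> 'a \<Rightarrow> 'a set" where
  "Ref R a = {x \<in> carrier R.
     a \<otimes>\<^bsub>R\<^esub> x \<otimes>\<^bsub>R\<^esub> a = a \<and> x \<otimes>\<^bsub>R\<^esub> a \<otimes>\<^bsub>R\<^esub> x = x}"

definition semiprime :: "('a, 'm) ring_scheme \<Rightarrow> bool" where
  "semiprime R \<longleftrightarrow> (\<forall>c \<in> carrier R.
     (\<forall>r \<in> carrier R. c \<otimes>\<^bsub>R\<^esub> r \<otimes>\<^bsub>R\<^esub> c = \<zero>\<^bsub>R\<^esub>) \<longrightarrow> c = \<zero>\<^bsub>R\<^esub>)"

end

theory Submission
  imports Defs
begin

text \<open>
  A regular element \<open>a\<close> has a reflexive inverse \<open>x\<close>, and then \<open>a = axa\<close> depends only on the two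
  idempotents \<open>xa\<close> and \<open>ax\<close>: if \<open>xa = xb\<close> and \<open>ax = bx\<close>, then \<open>a = axa = bxa = bxb = b\<close>.  So it
  suffices to recover both idempotents from the set of reflexive inverses.

  That set is closed under certain translations.  Every element of \<open>(1 - xa)R(ax)\<close> can be added
  to \<open>x\<close> without leaving \<open>Ref a\<close>.  If \<open>Ref a \<subseteq> Ref b\<close>, comparing \<open>bxb = b\<close> with
  \<open>b(x + d)b = b\<close> gives \<open>bdb = 0\<close> for all such \<open>d\<close>, that is, \<open>b(1 - xa)R(ax)b = 0\<close>.  Consequently
  \<open>c = (ax)b(1 - xa)\<close> satisfies \<open>cRc = 0\<close>, and semiprimeness yields \<open>c = 0\<close>.  Multiplying
  \<open>axb = axbxa\<close> by \<open>x\<close> on the left and using \<open>xax = xbx = x\<close> turns this into \<open>xb = xa\<close>.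
  Translations by \<open>(xa)R(1 - ax)\<close> give \<open>bx = ax\<close> in the same way with left and right exchanged.
\<close>

lemma RefD:
  assumes "x \<in> Ref R a"
  shows "x \<in> carrier R" "a \<otimes>\<^bsub>R\<^esub> x \<otimes>\<^bsub>R\<^esub> a = a" "x \<otimes>\<^bsub>R\<^esub> a \<otimes>\<^bsub>R\<^esub> x = x"
  using assms by (auto simp: Ref_def)

lemma semiprimeD:
  assumes "semiprime R" "c \<in> carrier R"
    and "\<And>r. r \<in> carrier R \<Longrightarrow> c \<otimes>\<^bsub>R\<^esub> r \<otimes>\<^bsub>R\<^esub> c = \<zero>\<^bsub>R\<^esub>"
  shows "c = \<zero>\<^bsub>R\<^esub>"
  using assms by (auto simp: semiprime_def)

context ring
begin

lemma diff_eq_zero_iff: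
  assumes [simp]: "u \<in> carrier R" "v \<in> carrier R"
  shows "u \<ominus> v = \<zero> \<longleftrightarrow> u = v"
proof
  assume "u \<ominus> v = \<zero>"
  then have "u \<ominus> v \<oplus> v = v" by simp
  then show "u = v" by (simp add: minus_eq a_assoc l_neg)
qed (simp add: minus_eq r_neg)

text \<open>An inner inverse \<open>x\<close> becomes reflexive when it is replaced by \<open>xax\<close>.\<close>

lemma Ref_nonempty:
  assumes "a \<in> Reg R"
  shows "Ref R a \<noteq> {}"
proof -
  from assms obtain x where x [simp]: "a \<in> carrier R" "x \<in> carrier R" and axa: "a \<otimes> x \<otimes> a = a"
    by (auto simp: Reg_def)
  have axa': "a \<otimes> (x \<otimes> (a \<otimes> z)) = a \<otimes> z" if "z \<in> carrier R" for z
    using that axa by (metis m_assoc m_closed x)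
  have "x \<otimes> a \<otimes> x \<in> Ref R a"
    using axa axa' by (simp add: Ref_def m_assoc)
  then show ?thesis by blast
qed

text \<open>The two translations that keep \<open>x\<close> inside \<open>Ref a\<close>: the first one leaves the idempotent
  \<open>ax\<close> unchanged, the second one \<open>xa\<close>.\<close>

lemma Ref_translate_left:
  assumes a [simp]: "a \<in> carrier R" and x: "x \<in> Ref R a"
    and d [simp]: "d \<in> carrier R" and ad: "a \<otimes> d = \<zero>" and dax: "d \<otimes> a \<otimes> x = d"
  shows "x \<oplus> d \<in> Ref R a"
proof -
  note [simp] = RefD(1)[OF x]
  have ay: "a \<otimes> (x \<oplus> d) = a \<otimes> x"
    by (simp add: r_distr ad)
  have "(x \<oplus> d) \<otimes> a \<otimes> (x \<oplus> d) = (x \<oplus> d) \<otimes> a \<otimes> x"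
    by (simp add: m_assoc ay)
  also have "\<dots> = x \<oplus> d"
    by (simp add: l_distr dax RefD(3)[OF x])
  finally show ?thesis
    by (simp add: Ref_def ay RefD(2)[OF x])
qed

lemma Ref_translate_right:
  assumes a [simp]: "a \<in> carrier R" and x: "x \<in> Ref R a"
    and d [simp]: "d \<in> carrier R" and da: "d \<otimes> a = \<zero>" and xad: "x \<otimes> a \<otimes> d = d"
  shows "x \<oplus> d \<in> Ref R a"
proof -
  note [simp] = RefD(1)[OF x]
  have ya: "(x \<oplus> d) \<otimes> a = x \<otimes> a"
    by (simp add: l_distr da)
  have "(x \<oplus> d) \<otimes> a \<otimes> (x \<oplus> d) = x \<oplus> d"
    by (simp add: ya r_distr xad RefD(3)[OF x])
  moreover have "a \<otimes> (x \<oplus> d) \<otimes> a = a"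
    using RefD(2)[OF x] by (simp add: m_assoc ya)
  ultimately show ?thesis
    by (simp add: Ref_def)
qed

lemma Ref_difference:
  assumes b [simp]: "b \<in> carrier R" and x: "x \<in> Ref R b"
    and d [simp]: "d \<in> carrier R" and xd: "x \<oplus> d \<in> Ref R b"
  shows "b \<otimes> d \<otimes> b = \<zero>"
proof -
  note [simp] = RefD(1)[OF x]
  have "b \<oplus> b \<otimes> d \<otimes> b = b \<otimes> (x \<oplus> d) \<otimes> b"
    by (simp add: r_distr l_distr RefD(2)[OF x])
  also have "\<dots> = b \<oplus> \<zero>"
    by (simp add: RefD(2)[OF xd])
  finally show ?thesis
    by (metis add.Units_l_cancel add.Units_eq b d m_closed zero_closed)
qed

text \<open>With \<open>d = (1 - xa)r(ax)\<close>, the element \<open>c = (ax)b(1 - xa)\<close> satisfies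
  \<open>crc = (ax)(bdb)(1 - xa) = 0\<close>.\<close>

lemma semiprime_Ref_subset_left_eq:
  assumes "semiprime R" and a [simp]: "a \<in> carrier R" and b [simp]: "b \<in> carrier R"
    and x: "x \<in> Ref R a" and sub: "Ref R a \<subseteq> Ref R b"
  shows "x \<otimes> a = x \<otimes> b"
proof -
  note xa = RefD[OF x]
  have x': "x \<in> Ref R b" using x sub by blast
  note xb = RefD[OF x']
  note [simp] = xa(1)
  define g where "g = \<one> \<ominus> x \<otimes> a"
  have g [simp]: "g \<in> carrier R" by (simp add: g_def)
  have ag: "a \<otimes> g = \<zero>"
    using xa(2) by (simp add: g_def minus_eq r_distr r_minus r_neg m_assoc)
  have axax: "a \<otimes> x \<otimes> a \<otimes> x = a \<otimes> x"
    by (simp add: xa(2))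
  have "a \<otimes> x \<otimes> b \<otimes> g = \<zero>"
  proof (rule semiprimeD[OF \<open>semiprime R\<close>])
    fix r assume r [simp]: "r \<in> carrier R"
    define d where "d = g \<otimes> r \<otimes> (a \<otimes> x)"
    have d [simp]: "d \<in> carrier R" by (simp add: d_def)
    have "a \<otimes> d = a \<otimes> g \<otimes> (r \<otimes> (a \<otimes> x))" by (simp add: d_def m_assoc)
    then have "a \<otimes> d = \<zero>" by (simp add: ag)
    moreover have "d \<otimes> a \<otimes> x = d"
      using axax by (simp add: d_def m_assoc)
    ultimately have "x \<oplus> d \<in> Ref R b"
      using Ref_translate_left[OF a x d] sub by blast
    then have bdb: "b \<otimes> d \<otimes> b = \<zero>"
      by (rule Ref_difference[OF b x' d])
    have "a \<otimes> x \<otimes> b \<otimes> g \<otimes> r \<otimes> (a \<otimes> x \<otimes> b \<otimes> g) = a \<otimes> x \<otimes> (b \<otimes> d \<otimes> b) \<otimes> g"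
      by (simp add: d_def m_assoc)
    then show "a \<otimes> x \<otimes> b \<otimes> g \<otimes> r \<otimes> (a \<otimes> x \<otimes> b \<otimes> g) = \<zero>"
      by (simp add: bdb)
  qed simp
  then have "x \<otimes> (a \<otimes> x \<otimes> b \<otimes> g) = \<zero>" by simp
  moreover have "x \<otimes> (a \<otimes> x \<otimes> b \<otimes> g) = x \<otimes> a \<otimes> x \<otimes> b \<otimes> g" by (simp add: m_assoc)
  ultimately have "x \<otimes> b \<otimes> g = \<zero>" by (simp add: xa(3))
  moreover have "x \<otimes> b \<otimes> g = x \<otimes> b \<ominus> x \<otimes> b \<otimes> x \<otimes> a"
    by (simp add: g_def minus_eq r_distr r_minus m_assoc)
  ultimately show ?thesis by (simp add: xb(3) diff_eq_zero_iff)
qed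

text \<open>The mirror image: here \<open>d = (xa)r(1 - ax)\<close> and \<open>c = (1 - ax)b(xa)\<close>.\<close>

lemma semiprime_Ref_subset_right_eq:
  assumes "semiprime R" and a [simp]: "a \<in> carrier R" and b [simp]: "b \<in> carrier R"
    and x: "x \<in> Ref R a" and sub: "Ref R a \<subseteq> Ref R b"
  shows "a \<otimes> x = b \<otimes> x"
proof -
  note xa = RefD[OF x]
  have x': "x \<in> Ref R b" using x sub by blast
  note xb = RefD[OF x']
  note [simp] = xa(1)
  define g where "g = \<one> \<ominus> a \<otimes> x"
  have g [simp]: "g \<in> carrier R" by (simp add: g_def)
  have ga: "g \<otimes> a = \<zero>"
    using xa(2) by (simp add: g_def minus_eq l_distr l_minus r_neg)
  have "g \<otimes> b \<otimes> (x \<otimes> a) = \<zero>"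
  proof (rule semiprimeD[OF \<open>semiprime R\<close>])
    fix r assume r [simp]: "r \<in> carrier R"
    define d where "d = x \<otimes> a \<otimes> r \<otimes> g"
    have d [simp]: "d \<in> carrier R" by (simp add: d_def)
    have "d \<otimes> a = \<zero>" by (simp add: d_def m_assoc ga)
    moreover have "x \<otimes> a \<otimes> d = x \<otimes> a \<otimes> x \<otimes> a \<otimes> r \<otimes> g"
      by (simp add: d_def m_assoc)
    then have "x \<otimes> a \<otimes> d = d"
      by (simp add: d_def xa(3))
    ultimately have "x \<oplus> d \<in> Ref R b"
      using Ref_translate_right[OF a x d] sub by blast
    then have bdb: "b \<otimes> d \<otimes> b = \<zero>"
      by (rule Ref_difference[OF b x' d])
    have "g \<otimes> b \<otimes> (x \<otimes> a) \<otimes> r \<otimes> (g \<otimes> b \<otimes> (x \<otimes> a)) = g \<otimes> (b \<otimes> d \<otimes> b) \<otimes> (x \<otimes> a)"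
      by (simp add: d_def m_assoc)
    then show "g \<otimes> b \<otimes> (x \<otimes> a) \<otimes> r \<otimes> (g \<otimes> b \<otimes> (x \<otimes> a)) = \<zero>"
      by (simp add: bdb)
  qed simp
  then have "g \<otimes> b \<otimes> (x \<otimes> a) \<otimes> x = \<zero>" by simp
  moreover have "g \<otimes> b \<otimes> (x \<otimes> a) \<otimes> x = g \<otimes> b \<otimes> (x \<otimes> a \<otimes> x)" by (simp add: m_assoc)
  ultimately have "g \<otimes> b \<otimes> x = \<zero>" by (simp add: xa(3))
  moreover have "g \<otimes> b \<otimes> x = b \<otimes> x \<ominus> a \<otimes> (x \<otimes> b \<otimes> x)"
    by (simp add: g_def minus_eq l_distr l_minus m_assoc)
  ultimately show ?thesis by (simp add: xb(3) diff_eq_zero_iff)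
qed

lemma semiprime_Ref_subset_imp_eq:
  assumes "semiprime R" "a \<in> Reg R" "b \<in> carrier R" "Ref R a \<subseteq> Ref R b"
  shows "a = b"
proof -
  have a: "a \<in> carrier R" using \<open>a \<in> Reg R\<close> by (simp add: Reg_def)
  obtain x where x: "x \<in> Ref R a" using Ref_nonempty[OF \<open>a \<in> Reg R\<close>] by blast
  have x': "x \<in> Ref R b" using x assms(4) by blast
  have "a = a \<otimes> x \<otimes> a" by (simp add: RefD(2)[OF x])
  also have "\<dots> = b \<otimes> x \<otimes> a"
    using semiprime_Ref_subset_right_eq[OF assms(1) a assms(3) x assms(4)] by simp
  also have "\<dots> = b \<otimes> (x \<otimes> a)" by (simp add: m_assoc a assms(3) RefD(1)[OF x])
  also have "\<dots> = b \<otimes> (x \<otimes> b)"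
    using semiprime_Ref_subset_left_eq[OF assms(1) a assms(3) x assms(4)] by simp
  also have "\<dots> = b \<otimes> x \<otimes> b" by (simp add: m_assoc assms(3) RefD(1)[OF x])
  also have "\<dots> = b" by (simp add: RefD(2)[OF x'])
  finally show ?thesis .
qed

end

theorem theorem10:
  fixes R :: "('a, 'm) ring_scheme" and a b :: 'a
  assumes "ring R" and "semiprime R"
    and "a \<in> Reg R" and "b \<in> Reg R"
  shows "Ref R a = Ref R b \<longleftrightarrow> a = b"
proof
  assume "Ref R a = Ref R b"
  moreover have "b \<in> carrier R" using \<open>b \<in> Reg R\<close> by (simp add: Reg_def)
  ultimately show "a = b"
    using ring.semiprime_Ref_subset_imp_eq[OF assms(1-3)] by blast
qed simp

end
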